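(* Let $C$ be a graph of colors, and let $G$ and $G'$ be two finite connected graphs colored by $C$. If $G$ and $G'$ have a common covering (i.e. there is a $C$-colored connected graph, possibly infinite, which admits color-preserving coverings to both $G$ and $G'$), then they have a common finite covering (i.e. there is a finite $C$-colored connected graph which admits color-preserving coverings to both $G$ and $G'$).
   Context: A graph is a connected $1$-complex. Combinatorially, a graph $G$ consists of a vertex set $V(G)$, a directed edge set $E(G)$, an involution $e\mapsto\bar e$ on $E(G)$ (reversal of direction), and maps $\partial_0,\partial_1\colon E(G)\to V(G)$ (tail and head) with $\partial_0\bar e=\partial_1 e$ for all $e$; an undirected edge is a pair $(e,\bar e)$. In an ordinary graph $e\neq\bar e$; in a graph of colors edges with $e=\bar e$ (half-edges) are also permitted, since such edges arise in quotients of graphs by automorphism groups. Multiple edges and loops are allowed. A graph-homomorphism maps vertices to vertices and directed edges to directed edges, commuting with $\partial_0,\partial_1$ and the involution. A coloring of a graph $G$ is a graph-homomorphism from $G$ to a fixed graph $C$, the graph of colors; the vertices and directed edges of $C$ are the vertex-colors and edge-colors. Homomorphisms of colored graphs are required to preserve colors, i.e. to commute with the homomorphisms to $C$. A covering of colored graphs is a color-preserving graph-homomorphism that is a covering map in the topological sense (equivalently, for connected nonempty graphs, one that restricts to a bijection from the set of directed edges with tail $v$ to the set of directed edges with tail the image of $v$, for every vertex $v$). *)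

theory Defs
  imports
    "Graph_Theory.Digraph_Component"
    "Graph_Theory.Bidirected_Digraph"
begin

text \<open>
  A graph is a \<^typ>\<open>('v, 'e) pre_digraph\<close> of directed edges together with the reversal of
  edges. Multiple edges and loops are allowed.
\<close>

record ('v, 'e) rev_graph =
  dgraph :: "('v, 'e) pre_digraph"
  erev :: "'e \<Rightarrow> 'e"

text \<open>
  Half-edges (edges fixed by the reversal) are permitted in a graph of colors. Connectedness is not
  required of it; a connected graph only ever uses the colors of one component.
\<close>

definition graph_of_colors :: "('a, 'b, 'm) rev_graph_scheme \<Rightarrow> bool" where
  "graph_of_colors C \<longleftrightarrow>
     wf_digraph (dgraph C) \<and>
     (\<forall>e \<in> arcs (dgraph C).
        erev C e \<in> arcs (dgraph C) \<and>
        erev C (erev C e) = e \<and>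
        tail (dgraph C) (erev C e) = head (dgraph C) e)"

text \<open>
  In an ordinary graph the reversal has no fixed edges. The library locale
  \<^locale>\<open>bidirected_digraph\<close> states this, with the convention that the reversal is the identity
  outside the edge set; \<^const>\<open>Digraph_Component.connected\<close> includes nonemptiness.
\<close>

definition connected_graph :: "('v, 'e, 'm) rev_graph_scheme \<Rightarrow> bool" where
  "connected_graph G \<longleftrightarrow>
     bidirected_digraph (dgraph G) (erev G) \<and> Digraph_Component.connected (dgraph G)"

definition finite_graph :: "('v, 'e, 'm) rev_graph_scheme \<Rightarrow> bool" where
  "finite_graph G \<longleftrightarrow> fin_digraph (dgraph G)"

definition graph_hom ::
  "('v, 'e, 'm) rev_graph_scheme \<Rightarrow> ('w, 'f, 'n) rev_graph_scheme \<Rightarrow> ('v \<Rightarrow> 'w) \<Rightarrow> ('e \<Rightarrow> 'f) \<Rightarrow> bool"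
where
  "graph_hom G H \<phi> \<psi> \<longleftrightarrow>
     (\<forall>v \<in> verts (dgraph G). \<phi> v \<in> verts (dgraph H)) \<and>
     (\<forall>e \<in> arcs (dgraph G).
        \<psi> e \<in> arcs (dgraph H) \<and>
        tail (dgraph H) (\<psi> e) = \<phi> (tail (dgraph G) e) \<and>
        head (dgraph H) (\<psi> e) = \<phi> (head (dgraph G) e) \<and>
        \<psi> (erev G e) = erev H (\<psi> e))"

text \<open>A colored graph carries its coloring, a homomorphism to the graph of colors.\<close>

record ('v, 'e, 'a, 'b) colored_graph = "('v, 'e) rev_graph" +
  vcolor :: "'v \<Rightarrow> 'a"
  ecolor :: "'e \<Rightarrow> 'b"

definition colored_by ::
  "('v, 'e, 'a, 'b) colored_graph \<Rightarrow> ('a, 'b) rev_graph \<Rightarrow> bool"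
where
  "colored_by G C \<longleftrightarrow> graph_hom G C (vcolor G) (ecolor G)"

definition color_preserving ::
  "('v, 'e, 'a, 'b) colored_graph \<Rightarrow> ('w, 'f, 'a, 'b) colored_graph
    \<Rightarrow> ('v \<Rightarrow> 'w) \<Rightarrow> ('e \<Rightarrow> 'f) \<Rightarrow> bool"
where
  "color_preserving G H \<phi> \<psi> \<longleftrightarrow>
     (\<forall>v \<in> verts (dgraph G). vcolor H (\<phi> v) = vcolor G v) \<and>
     (\<forall>e \<in> arcs (dgraph G). ecolor H (\<psi> e) = ecolor G e)"

text \<open>
  For nonempty connected graphs the condition on edge stars is equivalent to being a topological
  covering map; surjectivity is then automatic.
\<close>

definition colored_covering ::
  "('v, 'e, 'a, 'b) colored_graph \<Rightarrow> ('w, 'f, 'a, 'b) colored_graph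
    \<Rightarrow> ('v \<Rightarrow> 'w) \<Rightarrow> ('e \<Rightarrow> 'f) \<Rightarrow> bool"
where
  "colored_covering G H \<phi> \<psi> \<longleftrightarrow>
     graph_hom G H \<phi> \<psi> \<and>
     color_preserving G H \<phi> \<psi> \<and>
     (\<forall>v \<in> verts (dgraph G).
        bij_betw \<psi> (out_arcs (dgraph G) v) (out_arcs (dgraph H) (\<phi> v)))"

definition common_covering ::
  "('a, 'b) rev_graph \<Rightarrow> ('v, 'e, 'a, 'b) colored_graph \<Rightarrow> ('w, 'f, 'a, 'b) colored_graph
    \<Rightarrow> ('x, 'g, 'a, 'b) colored_graph \<Rightarrow> bool"
where
  "common_covering C G G' H \<longleftrightarrow>
     connected_graph H \<and> colored_by H C \<and>
     (\<exists>\<phi> \<psi>. colored_covering H G \<phi> \<psi>) \<and>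
     (\<exists>\<phi> \<psi>. colored_covering H G' \<phi> \<psi>)"

end

theory Submission
  imports Defs "HOL-Number_Theory.Cong"
begin

text \<open>
  Let \<open>D\<close> be the quotient of a common covering \<open>H\<close> that identifies whatever one of the two coverings
  identifies. The coloring of \<open>H\<close> and both coverings descend to \<open>D\<close>, and as coverings are bijective on
  stars, every vertex of \<open>G\<close> or \<open>G'\<close> over the tail of an arc \<open>k\<close> of \<open>D\<close> is the tail of the same
  number \<open>d k\<close> of arcs over \<open>k\<close>.

  Let \<open>n i\<close> and \<open>m k\<close> be the numbers of vertices over \<open>i\<close> and of arcs over \<open>k\<close> in \<open>G\<close>, so that
  \<open>m k = n (tail k) * d k\<close>, and let \<open>s\<close> be a common multiple of all these numbers. Following Leighton,
  take \<open>a i = s / n i\<close> copies of each pair of vertices over \<open>i\<close> and \<open>b k = s / m k\<close> copies of each pair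
  of arcs over \<open>k\<close>. The \<open>d k * d k * b k\<close> arcs over \<open>k\<close> that start above a pair of vertices are
  dealt to its \<open>a i = d k * b k\<close> copies by numbering the arcs over \<open>k\<close> in each star and adding the two
  numbers modulo \<open>d k\<close>, so that each copy receives every arc of either star exactly once. A component
  of the resulting finite graph is the required covering. Since \<open>b\<close> is invariant under reversal, arcs
  of \<open>D\<close> that are their own reversal need no special treatment.
\<close>

section \<open>Coverings\<close>

lemma colored_coveringD:
  assumes "colored_covering H G \<phi> \<psi>"
  shows "\<And>v. v \<in> verts (dgraph H) \<Longrightarrow> \<phi> v \<in> verts (dgraph G)"
    and "\<And>e. e \<in> arcs (dgraph H) \<Longrightarrow> \<psi> e \<in> arcs (dgraph G)"
    and "\<And>e. e \<in> arcs (dgraph H) \<Longrightarrow> tail (dgraph G) (\<psi> e) = \<phi> (tail (dgraph H) e)"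
    and "\<And>e. e \<in> arcs (dgraph H) \<Longrightarrow> head (dgraph G) (\<psi> e) = \<phi> (head (dgraph H) e)"
    and "\<And>e. e \<in> arcs (dgraph H) \<Longrightarrow> \<psi> (erev H e) = erev G (\<psi> e)"
    and "\<And>v. v \<in> verts (dgraph H) \<Longrightarrow> vcolor G (\<phi> v) = vcolor H v"
    and "\<And>e. e \<in> arcs (dgraph H) \<Longrightarrow> ecolor G (\<psi> e) = ecolor H e"
    and "\<And>v. v \<in> verts (dgraph H) \<Longrightarrow>
      bij_betw \<psi> (out_arcs (dgraph H) v) (out_arcs (dgraph G) (\<phi> v))"
  using assms by (auto simp: colored_covering_def graph_hom_def color_preserving_def)

lemma connected_graph_reachable:
  assumes "connected_graph G" "u \<in> verts (dgraph G)" "v \<in> verts (dgraph G)"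
  shows "u \<rightarrow>\<^sup>*\<^bsub>dgraph G\<^esub> v"
proof -
  interpret bidirected_digraph "dgraph G" "erev G"
    using assms by (simp add: connected_graph_def)
  have "connected (dgraph G)"
    using assms by (simp add: connected_graph_def)
  then have "strongly_connected (dgraph G)"
    by (rule symmetric_connected_imp_strongly_connected[OF sym_arcs])
  then show ?thesis using assms by auto
qed

text \<open>Stars of \<open>H\<close> map onto stars of \<open>G\<close>, so the image of
  \<open>\<phi>\<close> is closed under passing along an arc. It is nonempty and \<open>G\<close> is
  connected, so induction along paths exhausts \<open>G\<close>.\<close>

lemma covering_surj_verts:
  assumes cov: "colored_covering H G \<phi> \<psi>"
    and H: "wf_digraph (dgraph H)" "verts (dgraph H) \<noteq> {}" and G: "connected_graph G"
  shows "\<phi> ` verts (dgraph H) = verts (dgraph G)"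
proof
  interpret H: wf_digraph "dgraph H" by (rule H)
  interpret G: bidirected_digraph "dgraph G" "erev G"
    using G by (simp add: connected_graph_def)
  note cov = colored_coveringD[OF cov]
  show "\<phi> ` verts (dgraph H) \<subseteq> verts (dgraph G)" using cov by auto
  obtain h where h: "h \<in> verts (dgraph H)" using H by auto
  show "verts (dgraph G) \<subseteq> \<phi> ` verts (dgraph H)"
  proof
    fix v assume "v \<in> verts (dgraph G)"
    with connected_graph_reachable[OF G] h cov(1) have "\<phi> h \<rightarrow>\<^sup>*\<^bsub>dgraph G\<^esub> v" by auto
    then show "v \<in> \<phi> ` verts (dgraph H)"
    proof (induction rule: G.reachable_induct)
      case base
      then show ?case using h by auto
    next
      case (step x y)
      then obtain u e where u: "u \<in> verts (dgraph H)" "x = \<phi> u"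
        and e: "e \<in> out_arcs (dgraph G) x" "head (dgraph G) e = y"
        by auto
      then have "e \<in> \<psi> ` out_arcs (dgraph H) u"
        using bij_betw_imp_surj_on[OF cov(8)[of u]] by simp
      then obtain g where "g \<in> out_arcs (dgraph H) u" "\<psi> g = e" by blast
      then show ?case using cov(4)[of g] e by auto
    qed
  qed
qed

lemma covering_surj_arcs:
  assumes cov: "colored_covering H G \<phi> \<psi>"
    and H: "wf_digraph (dgraph H)" "verts (dgraph H) \<noteq> {}" and G: "connected_graph G"
  shows "\<psi> ` arcs (dgraph H) = arcs (dgraph G)"
proof
  interpret G: bidirected_digraph "dgraph G" "erev G"
    using G by (simp add: connected_graph_def)
  show "\<psi> ` arcs (dgraph H) \<subseteq> arcs (dgraph G)" using colored_coveringD[OF cov] by auto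
  show "arcs (dgraph G) \<subseteq> \<psi> ` arcs (dgraph H)"
  proof
    fix e assume e: "e \<in> arcs (dgraph G)"
    then have "tail (dgraph G) e \<in> \<phi> ` verts (dgraph H)"
      unfolding covering_surj_verts[OF assms] by (rule G.tail_in_verts)
    then obtain u where u: "u \<in> verts (dgraph H)" "\<phi> u = tail (dgraph G) e"
      by (metis imageE)
    then have "e \<in> \<psi> ` out_arcs (dgraph H) u"
      using bij_betw_imp_surj_on[OF colored_coveringD(8)[OF cov u(1)]] u(2) e by simp
    then show "e \<in> \<psi> ` arcs (dgraph H)" by auto
  qed
qed

lemma colored_covering_comp:
  assumes "colored_covering K H \<phi> \<psi>" "colored_covering H G \<phi>' \<psi>'"
  shows "colored_covering K G (\<phi>' \<circ> \<phi>) (\<psi>' \<circ> \<psi>)"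
  unfolding colored_covering_def
proof (intro conjI ballI)
  note c = colored_coveringD[OF assms(1)] and c' = colored_coveringD[OF assms(2)]
  show "graph_hom K G (\<phi>' \<circ> \<phi>) (\<psi>' \<circ> \<psi>)"
    by (simp add: graph_hom_def c c')
  show "color_preserving K G (\<phi>' \<circ> \<phi>) (\<psi>' \<circ> \<psi>)"
    by (simp add: color_preserving_def c c')
  show "bij_betw (\<psi>' \<circ> \<psi>) (out_arcs (dgraph K) v) (out_arcs (dgraph G) ((\<phi>' \<circ> \<phi>) v))"
    if "v \<in> verts (dgraph K)" for v
    using bij_betw_trans[OF c(8)[OF that] c'(8)[OF c(1)[OF that]]] by simp
qed

text \<open>The coloring of \<open>H\<close> is that of \<open>G\<close> pulled back along the
  covering, so the homomorphism laws are inherited. The final graph obtains its coloring by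
  \<open>C\<close> in this way.\<close>

lemma colored_covering_colored_by:
  assumes "colored_covering H G \<phi> \<psi>" "colored_by G C"
    and H: "bidirected_digraph (dgraph H) (erev H)"
  shows "colored_by H C"
proof -
  interpret H: bidirected_digraph "dgraph H" "erev H" by (rule H)
  note c = colored_coveringD[OF assms(1)]
  have G: "\<And>v. v \<in> verts (dgraph G) \<Longrightarrow> vcolor G v \<in> verts (dgraph C)"
    "\<And>e. e \<in> arcs (dgraph G) \<Longrightarrow> ecolor G e \<in> arcs (dgraph C) \<and>
      tail (dgraph C) (ecolor G e) = vcolor G (tail (dgraph G) e) \<and>
      head (dgraph C) (ecolor G e) = vcolor G (head (dgraph G) e) \<and>
      ecolor G (erev G e) = erev C (ecolor G e)"
    using assms(2) by (auto simp: colored_by_def graph_hom_def)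
  show ?thesis
    unfolding colored_by_def graph_hom_def
  proof (intro conjI ballI)
    show "vcolor H v \<in> verts (dgraph C)" if "v \<in> verts (dgraph H)" for v
      using G(1)[OF c(1)[OF that]] c(6)[OF that] by simp
  next
    fix e assume e: "e \<in> arcs (dgraph H)"
    note Ge = G(2)[OF c(2)[OF e]]
    show "ecolor H e \<in> arcs (dgraph C)" using Ge c(7)[OF e] by simp
    show "tail (dgraph C) (ecolor H e) = vcolor H (tail (dgraph H) e)"
      using Ge c(3,7)[OF e] c(6)[of "tail (dgraph H) e"] e by simp
    show "head (dgraph C) (ecolor H e) = vcolor H (head (dgraph H) e)"
      using Ge c(4,7)[OF e] c(6)[of "head (dgraph H) e"] e by simp
    show "ecolor H (erev H e) = erev C (ecolor H e)"
      using Ge c(5,7)[OF e] c(7)[of "erev H e"] e by simp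
  qed
qed

section \<open>Relabelling and connected components\<close>

text \<open>Changing the types allows the final cover to live on natural numbers. The reversal is
  the identity off the arc set, as \<open>bidirected_digraph\<close> demands.\<close>

definition relabel :: "('v \<Rightarrow> 'w) \<Rightarrow> ('e \<Rightarrow> 'f) \<Rightarrow> ('v, 'e, 'a, 'b) colored_graph \<Rightarrow> ('w, 'f, 'a, 'b) colored_graph"
where
  "relabel f g K = (let f' = inv_into (verts (dgraph K)) f; g' = inv_into (arcs (dgraph K)) g in
     \<lparr>dgraph = \<lparr>verts = f ` verts (dgraph K), arcs = g ` arcs (dgraph K),
        tail = f \<circ> tail (dgraph K) \<circ> g', head = f \<circ> head (dgraph K) \<circ> g'\<rparr>,
      erev = (\<lambda>a. if a \<in> g ` arcs (dgraph K) then g (erev K (g' a)) else a),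
      vcolor = vcolor K \<circ> f', ecolor = ecolor K \<circ> g'\<rparr>)"

text \<open>The inverse renaming is an isomorphism onto \<open>K\<close>, hence in particular a
  covering.\<close>

lemma relabel_covering:
  assumes K: "bidirected_digraph (dgraph K) (erev K)" "finite_graph K"
    and f: "inj_on f (verts (dgraph K))" and g: "inj_on g (arcs (dgraph K))"
  shows "bidirected_digraph (dgraph (relabel f g K)) (erev (relabel f g K))"
    and "finite_graph (relabel f g K)"
    and "colored_covering (relabel f g K) K (inv_into (verts (dgraph K)) f) (inv_into (arcs (dgraph K)) g)"
proof -
  interpret K: bidirected_digraph "dgraph K" "erev K" by (rule K)
  interpret F: fin_digraph "dgraph K" using K by (simp add: finite_graph_def)
  let ?f' = "inv_into (verts (dgraph K)) f" and ?g' = "inv_into (arcs (dgraph K)) g"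
  have f' [simp]: "\<And>v. v \<in> verts (dgraph K) \<Longrightarrow> ?f' (f v) = v"
    and g' [simp]: "\<And>e. e \<in> arcs (dgraph K) \<Longrightarrow> ?g' (g e) = e"
    using f g by simp_all
  show B: "bidirected_digraph (dgraph (relabel f g K)) (erev (relabel f g K))"
  proof
    fix e
    show "e \<in> arcs (dgraph (relabel f g K)) \<longleftrightarrow> erev (relabel f g K) e \<noteq> e"
      using K.arev_neq inj_on_eq_iff[OF g] by (auto simp: relabel_def Let_def)
  qed (auto simp: relabel_def Let_def inj_on_eq_iff[OF g])
  interpret B: bidirected_digraph "dgraph (relabel f g K)" "erev (relabel f g K)" by (rule B)
  show "finite_graph (relabel f g K)"
    unfolding finite_graph_def by (intro B.fin_digraphI) (simp_all add: relabel_def Let_def)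
  show "colored_covering (relabel f g K) K ?f' ?g'"
    unfolding colored_covering_def
  proof (intro conjI ballI)
    fix w assume "w \<in> verts (dgraph (relabel f g K))"
    then obtain v where v: "v \<in> verts (dgraph K)" "w = f v" by (auto simp: relabel_def Let_def)
    have "out_arcs (dgraph (relabel f g K)) w = g ` out_arcs (dgraph K) v"
      using v inj_onD[OF f] by (auto simp: relabel_def Let_def)
    moreover have "inj_on g (out_arcs (dgraph K) v)"
      using g by (rule inj_on_subset) auto
    ultimately show "bij_betw ?g' (out_arcs (dgraph (relabel f g K)) w) (out_arcs (dgraph K) (?f' w))"
      using v by (intro bij_betw_byWitness[where f' = g]) auto
  qed (auto simp: relabel_def Let_def graph_hom_def color_preserving_def)
qed

definition induced_colored :: "('v, 'e, 'a, 'b) colored_graph \<Rightarrow> 'v set \<Rightarrow> ('v, 'e, 'a, 'b) colored_graph" where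
  "induced_colored K S = K\<lparr>dgraph := dgraph K \<restriction> S,
     erev := (\<lambda>e. if e \<in> arcs (dgraph K \<restriction> S) then erev K e else e)\<rparr>"

text \<open>Every arc that starts in the reachable set also ends in it, so no star is cut and the
  inclusion is a covering. As the arcs are symmetric, the set reachable from \<open>u\<close> is
  strongly connected.\<close>

lemma component_covering:
  fixes u
  assumes K: "bidirected_digraph (dgraph K) (erev K)" "finite_graph K" "u \<in> verts (dgraph K)"
  defines "L \<equiv> induced_colored K {v. u \<rightarrow>\<^sup>*\<^bsub>dgraph K\<^esub> v}"
  shows "connected_graph L" and "finite_graph L" and "colored_covering L K id id"
proof -
  interpret K: bidirected_digraph "dgraph K" "erev K" by (rule K)
  interpret F: fin_digraph "dgraph K" using K by (simp add: finite_graph_def)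
  let ?S = "{v. u \<rightarrow>\<^sup>*\<^bsub>dgraph K\<^esub> v}"
  have S: "?S \<subseteq> verts (dgraph K)" by (auto elim: reachable_in_vertsE)
  have closed: "head (dgraph K) e \<in> ?S"
    if "e \<in> arcs (dgraph K)" "tail (dgraph K) e \<in> ?S" for e
    using that K.reachable_adj_trans[of u "tail (dgraph K) e" "head (dgraph K) e"]
    K.dominatesI[of e] by (simp add: arc_to_ends_def)
  have L: "dgraph L = dgraph K \<restriction> ?S" "vcolor L = vcolor K" "ecolor L = ecolor K"
      "\<And>e. e \<in> arcs (dgraph L) \<Longrightarrow> erev L e = erev K e"
      "\<And>e. e \<notin> arcs (dgraph L) \<Longrightarrow> erev L e = e"
    by (simp_all add: L_def induced_colored_def del: induce_subgraph_arcs)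
  have arcs: "e \<in> arcs (dgraph L) \<longleftrightarrow> e \<in> arcs (dgraph K) \<and> tail (dgraph K) e \<in> ?S" for e
    using closed by (auto simp: L)
  interpret wL: wf_digraph "dgraph L" unfolding L by (rule K.wellformed_induce_subgraph)
  have rev: "erev K e \<in> arcs (dgraph L)" if "e \<in> arcs (dgraph L)" for e
    using that by (simp add: L)
  have B: "bidirected_digraph (dgraph L) (erev L)"
  proof (rule wL.bidirected_digraphI)
    fix e assume e: "e \<in> arcs (dgraph L)"
    then have eK: "e \<in> arcs (dgraph K)" by (simp add: arcs)
    show "erev L e \<noteq> e" using e eK by (simp add: L(4) K.arev_neq)
    show "erev L (erev L e) = e" using e rev[OF e] by (simp add: L(4))
    show "tail (dgraph L) (erev L e) = head (dgraph L) e" using e eK by (simp add: L(4)) (simp add: L(1))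
  qed (rule L(5))
  interpret bidirected_digraph "dgraph L" "erev L" by (rule B)
  have "strongly_connected (dgraph L)"
    unfolding L(1) using K.induce_reachable_is_in_sccs[OF K(3)] by (auto simp: K.sccs_def)
  then have "connected (dgraph L)"
    unfolding connected_def strongly_connected_def
    by (auto intro: wL.reachable_mk_symmetricI)
  with B show "connected_graph L" by (simp add: connected_graph_def)
  show "finite_graph L"
    unfolding finite_graph_def
    using finite_subset[OF S] by (intro wL.fin_digraphI) (auto simp: L(1))
  show "colored_covering L K id id"
    unfolding colored_covering_def
  proof (intro conjI ballI)
    show "graph_hom L K id id" using S by (auto simp: graph_hom_def L(4)) (auto simp: L(1))
    show "color_preserving L K id id" by (simp add: color_preserving_def L)
    fix v assume v: "v \<in> verts (dgraph L)"
    have "out_arcs (dgraph L) v = out_arcs (dgraph K) v"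
      using v closed by (auto simp: L(1))
    then show "bij_betw id (out_arcs (dgraph L) v) (out_arcs (dgraph K) (id v))" by simp
  qed
qed

section \<open>Equitable quotients\<close>

definition star_part :: "('v, 'e, 'm) rev_graph_scheme \<Rightarrow> ('e \<Rightarrow> 'k) \<Rightarrow> 'v \<Rightarrow> 'k \<Rightarrow> 'e set" where
  "star_part G \<kappa> v k = {e \<in> out_arcs (dgraph G) v. \<kappa> e = k}"

lemma in_star_part [simp]:
  "e \<in> star_part G \<kappa> v k \<longleftrightarrow> e \<in> arcs (dgraph G) \<and> tail (dgraph G) e = v \<and> \<kappa> e = k"
  by (auto simp: star_part_def)

text \<open>A covering relaxed to allow \<open>d k\<close> lifts of an arc \<open>k\<close> at each
  vertex above its tail; the fibres form an equitable partition of \<open>G\<close>. The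
  multiplicity depends on \<open>k\<close> alone, so two graphs over the same \<open>D\<close> can
  share one \<open>d\<close>.\<close>

definition equitable_hom ::
  "('v, 'e, 'a, 'b) colored_graph \<Rightarrow> ('i, 'k, 'a, 'b) colored_graph
    \<Rightarrow> ('v \<Rightarrow> 'i) \<Rightarrow> ('e \<Rightarrow> 'k) \<Rightarrow> ('k \<Rightarrow> nat) \<Rightarrow> bool"
where
  "equitable_hom G D \<gamma> \<kappa> d \<longleftrightarrow>
     graph_hom G D \<gamma> \<kappa> \<and> color_preserving G D \<gamma> \<kappa> \<and>
     (\<forall>v \<in> verts (dgraph G). \<forall>k \<in> out_arcs (dgraph D) (\<gamma> v). card (star_part G \<kappa> v k) = d k)"

section \<open>Descent of homomorphisms and the quotient by two coverings\<close>

text \<open>Constancy on generating pairs extends to whole classes by induction along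
  \<open>equivclp\<close>, so \<open>f\<close> may be evaluated at any representative. Tail, head,
  reversal, colors and star counts of the quotient are all obtained from this.\<close>

lemma equivclp_factor:
  assumes "\<And>x y. r x y \<Longrightarrow> f x = f y"
  shows "\<exists>F. \<forall>x. F (Collect (equivclp r x)) = f x"
proof (intro exI allI)
  fix x
  let ?y = "SOME y. equivclp r x y"
  have "equivclp r x ?y" by (rule someI[of _ x]) simp
  then have "f ?y = f x"
    by (induction rule: equivclp_induct) (auto dest: assms)
  then show "(\<lambda>c. f (SOME y. y \<in> c)) (Collect (equivclp r x)) = f x" by simp
qed

lemma equivclp_class_eq: "r x y \<Longrightarrow> Collect (equivclp r x) = Collect (equivclp r y)"
  using equivp_evquivclp[of r] by (metis equivp_def r_into_equivclp)

text \<open>\<open>\<psi>\<close> matches the arcs of class \<open>k\<close> at \<open>h\<close>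
  with the arcs at \<open>\<phi> h\<close> that have some lift in class \<open>k\<close>. The
  right-hand side depends on \<open>h\<close> only through \<open>\<phi> h\<close>, so vertices
  identified by the covering have equal counts.\<close>

lemma card_star_part_covering:
  assumes cov: "colored_covering H G \<phi> \<psi>"
    and q: "\<And>g g'. g \<in> arcs (dgraph H) \<Longrightarrow> g' \<in> arcs (dgraph H) \<Longrightarrow> \<psi> g = \<psi> g' \<Longrightarrow> q g = q g'"
    and h: "h \<in> verts (dgraph H)"
  shows "card (star_part H q h k) =
    card {e \<in> out_arcs (dgraph G) (\<phi> h). e \<in> \<psi> ` {g \<in> arcs (dgraph H). q g = k}}"
proof (rule bij_betw_same_card)
  have b: "bij_betw \<psi> (out_arcs (dgraph H) h) (out_arcs (dgraph G) (\<phi> h))"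
    by (rule colored_coveringD(8)[OF cov h])
  have "\<psi> ` star_part H q h k =
      {e \<in> out_arcs (dgraph G) (\<phi> h). e \<in> \<psi> ` {g \<in> arcs (dgraph H). q g = k}}" (is "_ = ?R")
  proof
    show "\<psi> ` star_part H q h k \<subseteq> ?R"
      using b by (auto dest: bij_betw_apply)
    show "?R \<subseteq> \<psi> ` star_part H q h k"
    proof
      fix e assume "e \<in> ?R"
      then obtain g' where g': "\<psi> g' = e" "g' \<in> arcs (dgraph H)" "q g' = k" by blast
      have "e \<in> \<psi> ` out_arcs (dgraph H) h"
        using \<open>e \<in> ?R\<close> bij_betw_imp_surj_on[OF b] by simp
      \<comment> \<open>The lift \<open>g\<close> of \<open>e\<close> at \<open>h\<close> may differ
        from \<open>g'\<close>, but it lies in the same class because \<open>q\<close> is constant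
        on the fibres of \<open>\<psi>\<close>.\<close>
      then obtain g where "g \<in> out_arcs (dgraph H) h" "\<psi> g = e" by blast
      with g' q[of g g'] have "g \<in> star_part H q h k" by simp
      with \<open>\<psi> g = e\<close> show "e \<in> \<psi> ` star_part H q h k" by blast
    qed
  qed
  then show "bij_betw \<psi> (star_part H q h k) ?R"
    using b by (auto simp: bij_betw_def star_part_def intro: inj_on_subset)
qed

text \<open>Maps constant on the fibres of a surjective covering factor through it, and star counts
  agree by \<open>card_star_part_covering\<close>. The equation for
  \<open>\<gamma> (\<phi> h)\<close> is kept because it later supplies vertices of the two graphs
  over the same vertex of \<open>D\<close>.\<close>

lemma equitable_hom_descend:
  assumes cov: "colored_covering H G \<phi> \<psi>"
    and H: "connected_graph H" and G: "connected_graph G"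
    and pq: "equitable_hom H D p q d"
    and p: "\<And>h h'. h \<in> verts (dgraph H) \<Longrightarrow> h' \<in> verts (dgraph H) \<Longrightarrow> \<phi> h = \<phi> h' \<Longrightarrow> p h = p h'"
    and q: "\<And>g g'. g \<in> arcs (dgraph H) \<Longrightarrow> g' \<in> arcs (dgraph H) \<Longrightarrow> \<psi> g = \<psi> g' \<Longrightarrow> q g = q g'"
  shows "\<exists>\<gamma> \<kappa>. equitable_hom G D \<gamma> \<kappa> d \<and> (\<forall>h \<in> verts (dgraph H). \<gamma> (\<phi> h) = p h)"
proof -
  interpret H: bidirected_digraph "dgraph H" "erev H"
    using H by (simp add: connected_graph_def)
  have ne: "verts (dgraph H) \<noteq> {}"
    using H by (auto simp: connected_graph_def connected_conv)
  note V = covering_surj_verts[OF cov H.wf_digraph ne G]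
  note E = covering_surj_arcs[OF cov H.wf_digraph ne G]
  note c = colored_coveringD[OF cov]
  define \<gamma> where "\<gamma> v = p (inv_into (verts (dgraph H)) \<phi> v)" for v
  define \<kappa> where "\<kappa> e = q (inv_into (arcs (dgraph H)) \<psi> e)" for e
  have \<gamma>: "\<gamma> (\<phi> h) = p h" if "h \<in> verts (dgraph H)" for h
    unfolding \<gamma>_def using that by (intro p inv_into_into f_inv_into_f) auto
  have \<kappa>: "\<kappa> (\<psi> g) = q g" if "g \<in> arcs (dgraph H)" for g
    unfolding \<kappa>_def using that by (intro q inv_into_into f_inv_into_f) auto
  have pq': "graph_hom H D p q" "color_preserving H D p q"
    using pq by (auto simp: equitable_hom_def)
  have "graph_hom G D \<gamma> \<kappa>"
    unfolding graph_hom_def V[symmetric] E[symmetric]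
    using pq'(1) by (auto simp: graph_hom_def \<gamma> \<kappa> c simp flip: c(5))
  moreover have "color_preserving G D \<gamma> \<kappa>"
    unfolding color_preserving_def V[symmetric] E[symmetric]
    using pq'(2) by (auto simp: color_preserving_def \<gamma> \<kappa> c)
  moreover have "card (star_part G \<kappa> (\<phi> h) k) = d k"
    if "h \<in> verts (dgraph H)" "k \<in> out_arcs (dgraph D) (\<gamma> (\<phi> h))" for h k
  proof -
    have "star_part G \<kappa> (\<phi> h) k =
        {e \<in> out_arcs (dgraph G) (\<phi> h). e \<in> \<psi> ` {g \<in> arcs (dgraph H). q g = k}}"
      by (auto simp: E[symmetric] \<kappa>)
    also have "card \<dots> = card (star_part H q h k)"
      by (rule card_star_part_covering[OF cov q that(1), symmetric])
    also have "\<dots> = d k"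
      using pq that unfolding equitable_hom_def \<gamma>[OF that(1)] by blast
    finally show ?thesis .
  qed
  ultimately have "equitable_hom G D \<gamma> \<kappa> d"
    unfolding equitable_hom_def V[symmetric] by auto
  with \<gamma> show ?thesis by blast
qed

text \<open>\<open>D\<close> divides the vertices and the arcs of \<open>H\<close> by the
  equivalences generated by both coverings. Each map needed on \<open>D\<close> respects the
  generating pairs, whichever covering they come from, and so descends.\<close>

lemma common_equitable_quotient:
  fixes H :: "('x, 'g, 'a, 'b) colored_graph"
  assumes cov: "colored_covering H G \<phi> \<psi>" and cov': "colored_covering H G' \<phi>' \<psi>'"
    and H: "bidirected_digraph (dgraph H) (erev H)"
  obtains D :: "('x set, 'g set, 'a, 'b) colored_graph" and p q d where
    "equitable_hom H D p q d"
    "\<forall>h \<in> verts (dgraph H). \<forall>h' \<in> verts (dgraph H). \<phi> h = \<phi> h' \<or> \<phi>' h = \<phi>' h' \<longrightarrow> p h = p h'"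
    "\<forall>g \<in> arcs (dgraph H). \<forall>g' \<in> arcs (dgraph H). \<psi> g = \<psi> g' \<or> \<psi>' g = \<psi>' g' \<longrightarrow> q g = q g'"
proof -
  interpret H: bidirected_digraph "dgraph H" "erev H" by (rule H)
  note c = colored_coveringD[OF cov] and c' = colored_coveringD[OF cov']
  \<comment> \<open>The disjunction need not be transitive, so \<open>r\<close> and \<open>s\<close>
    only generate the equivalences used below. They are restricted to the graph, where the covering
    laws apply.\<close>
  define r where "r h h' \<longleftrightarrow> h \<in> verts (dgraph H) \<and> h' \<in> verts (dgraph H) \<and> (\<phi> h = \<phi> h' \<or> \<phi>' h = \<phi>' h')" for h h'
  define s where "s g g' \<longleftrightarrow> g \<in> arcs (dgraph H) \<and> g' \<in> arcs (dgraph H) \<and> (\<psi> g = \<psi> g' \<or> \<psi>' g = \<psi>' g')" for g g'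
  define p where "p h = Collect (equivclp r h)" for h
  define q where "q g = Collect (equivclp s g)" for g
  have p: "r h h' \<Longrightarrow> p h = p h'" for h h'
    unfolding p_def by (rule equivclp_class_eq)
  have q: "s g g' \<Longrightarrow> q g = q g'" for g g'
    unfolding q_def by (rule equivclp_class_eq)
  have "s g g' \<Longrightarrow> p (tail (dgraph H) g) = p (tail (dgraph H) g')" for g g'
    by (rule p) (auto simp: r_def s_def simp flip: c(3) c'(3))
  then obtain T where T: "\<And>g. T (q g) = p (tail (dgraph H) g)"
    using equivclp_factor[of s "\<lambda>g. p (tail (dgraph H) g)"] unfolding q_def by blast
  have "s g g' \<Longrightarrow> p (head (dgraph H) g) = p (head (dgraph H) g')" for g g'
    by (rule p) (auto simp: r_def s_def simp flip: c(4) c'(4))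
  then obtain Hd where Hd: "\<And>g. Hd (q g) = p (head (dgraph H) g)"
    using equivclp_factor[of s "\<lambda>g. p (head (dgraph H) g)"] unfolding q_def by blast
  have "s g g' \<Longrightarrow> q (erev H g) = q (erev H g')" for g g'
    by (rule q) (auto simp: s_def c(5) c'(5))
  then obtain R where R: "\<And>g. R (q g) = q (erev H g)"
    using equivclp_factor[of s "\<lambda>g. q (erev H g)"] unfolding q_def by blast
  have "s g g' \<Longrightarrow> ecolor H g = ecolor H g'" for g g'
    by (auto simp: s_def simp flip: c(7)) (metis c'(7) c(7))
  then obtain CE where CE: "\<And>g. CE (q g) = ecolor H g"
    using equivclp_factor[of s "ecolor H"] unfolding q_def by blast
  have "r h h' \<Longrightarrow> vcolor H h = vcolor H h'" for h h'
    by (auto simp: r_def simp flip: c(6)) (metis c'(6) c(6))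
  then obtain CV where CV: "\<And>h. CV (p h) = vcolor H h"
    using equivclp_factor[of r "vcolor H"] unfolding p_def by blast
  \<comment> \<open>The counts for all \<open>k\<close> are bundled into one function of
    \<open>h\<close>, so that a single descent yields them on the vertices of
    \<open>D\<close>.\<close>
  have "r h h' \<Longrightarrow> (\<lambda>k. card (star_part H q h k)) = (\<lambda>k. card (star_part H q h' k))" for h h'
  proof -
    assume r: "r h h'"
    have "q g = q g'" if "g \<in> arcs (dgraph H)" "g' \<in> arcs (dgraph H)" "\<psi> g = \<psi> g'" for g g'
      using that by (intro q) (auto simp: s_def)
    note star = card_star_part_covering[where q = q, OF cov this]
    have "q g = q g'" if "g \<in> arcs (dgraph H)" "g' \<in> arcs (dgraph H)" "\<psi>' g = \<psi>' g'" for g g'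
      using that by (intro q) (auto simp: s_def)
    note star' = card_star_part_covering[where q = q, OF cov' this]
    have h: "h \<in> verts (dgraph H)" "h' \<in> verts (dgraph H)" and or: "\<phi> h = \<phi> h' \<or> \<phi>' h = \<phi>' h'"
      using r by (auto simp: r_def)
    from or show ?thesis
    proof
      assume "\<phi> h = \<phi> h'"
      then show ?thesis using star[OF _ _ _ h(1)] star[OF _ _ _ h(2)] by presburger
    next
      assume "\<phi>' h = \<phi>' h'"
      then show ?thesis using star'[OF _ _ _ h(1)] star'[OF _ _ _ h(2)] by presburger
    qed
  qed
  then obtain N where N: "\<And>h. N (p h) = (\<lambda>k. card (star_part H q h k))"
    using equivclp_factor[of r "\<lambda>h k. card (star_part H q h k)"] unfolding p_def by blast
  define D where "D = \<lparr>dgraph = \<lparr>verts = p ` verts (dgraph H), arcs = q ` arcs (dgraph H), tail = T, head = Hd\<rparr>,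
    erev = R, vcolor = CV, ecolor = CE\<rparr>"
  \<comment> \<open>The multiplicity of \<open>k\<close> is read off at \<open>T k\<close>, the
    class of the tails of its members.\<close>
  have "equitable_hom H D p q (\<lambda>k. N (T k) k)"
    by (auto simp: equitable_hom_def graph_hom_def color_preserving_def D_def T Hd R CE CV N)
  then show thesis
    by (rule that) (intro ballI impI p q; simp add: r_def s_def)+
qed

section \<open>The product of two equitably colored graphs\<close>

lemma ex1D: "\<exists>!x. P x \<Longrightarrow> P x \<Longrightarrow> P y \<Longrightarrow> x = y"
  by blast

text \<open>Division of \<open>x\<close> by \<open>d\<close> recovers \<open>snd p\<close> as
  quotient and \<open>(r + \<sigma> (fst p)) mod d\<close> as remainder; adding \<open>r\<close>
  only rotates the residues, so the remainder determines \<open>fst p\<close>. With \<open>r\<close>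
  the number of a fixed arc, each copy \<open>x\<close> thus receives exactly one partner
  arc.\<close>

lemma ex1_slot:
  fixes b d r x :: nat
  assumes \<sigma>: "bij_betw \<sigma> B {..<d}" and x: "x < d * b"
  shows "\<exists>!p. p \<in> B \<times> {..<b} \<and> snd p * d + (r + \<sigma> (fst p)) mod d = x"
proof -
  have d: "0 < d" using x by (cases d) auto
  have slot: "y * d + t mod d = x \<longleftrightarrow> y = x div d \<and> t mod d = x mod d" for y t
    using d by (auto simp: mult.commute)
  \<comment> \<open>This is \<open>x - r\<close> modulo \<open>d\<close>; the summand
    \<open>d - r mod d\<close> keeps the subtraction within the natural numbers.\<close>
  let ?t = "(x + (d - r mod d)) mod d"
  obtain f where f: "f \<in> B" "\<sigma> f = ?t"
    using \<sigma> d by (metis bij_betw_def imageE lessThan_iff mod_less_divisor)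
  have "(r + ?t) mod d = (r mod d + (x + (d - r mod d))) mod d"
    by (simp add: mod_simps)
  also have "r mod d + (x + (d - r mod d)) = x + d"
    using mod_less_divisor[OF d, of r] by linarith
  finally have rt: "(r + ?t) mod d = x mod d" by simp
  show ?thesis
  proof (rule ex1I[of _ "(f, x div d)"])
    show "(f, x div d) \<in> B \<times> {..<b} \<and>
        snd (f, x div d) * d + (r + \<sigma> (fst (f, x div d))) mod d = x"
      using f rt x d slot by (auto simp: less_mult_imp_div_less mult.commute)
  next
    fix p assume p: "p \<in> B \<times> {..<b} \<and> snd p * d + (r + \<sigma> (fst p)) mod d = x"
    then have "snd p = x div d" "(r + \<sigma> (fst p)) mod d = (r + \<sigma> f) mod d"
      using slot rt f by auto
    then have "[\<sigma> (fst p) = \<sigma> f] (mod d)"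
      by (metis cong_add_lcancel_nat cong_def)
    moreover have "\<sigma> (fst p) < d" "\<sigma> f < d"
      using p f \<sigma> by (auto dest: bij_betw_apply)
    ultimately have "\<sigma> (fst p) = \<sigma> f"
      by (simp add: cong_def)
    then have "fst p = f"
      using p f \<sigma> by (metis bij_betw_imp_inj_on inj_onD mem_Times_iff)
    with \<open>snd p = x div d\<close> show "p = (f, x div d)" by (metis prod.collapse)
  qed
qed

text \<open>An arc determines its tail and its class, so numberings chosen separately on the star
  parts merge into one function on arcs.\<close>

lemma equitable_hom_ranking:
  assumes "finite_graph G" "equitable_hom G D \<gamma> \<kappa> d"
  obtains \<rho> :: "'e \<Rightarrow> nat"
  where "\<And>v k. v \<in> verts (dgraph G) \<Longrightarrow> k \<in> arcs (dgraph D) \<Longrightarrow> tail (dgraph D) k = \<gamma> v \<Longrightarrow>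
      bij_betw \<rho> (star_part (G :: ('v, 'e, 'a, 'b) colored_graph) \<kappa> v k) {..<d k}"
proof -
  interpret fin_digraph "dgraph G" using assms(1) by (simp add: finite_graph_def)
  have fin: "finite (star_part G \<kappa> v k)" for v k
    unfolding star_part_def by (rule finite_subset[OF _ finite_arcs]) auto
  have "\<forall>v k. \<exists>f. bij_betw f (star_part G \<kappa> v k) {..<card (star_part G \<kappa> v k)}"
    using ex_bij_betw_finite_nat[OF fin] by (simp add: atLeast0LessThan)
  then obtain F where F: "bij_betw (F v k) (star_part G \<kappa> v k) {..<card (star_part G \<kappa> v k)}" for v k
    by metis
  show thesis
  proof (rule that[of "\<lambda>e. F (tail (dgraph G) e) (\<kappa> e) e"])
    fix v k assume "v \<in> verts (dgraph G)" "k \<in> arcs (dgraph D)" "tail (dgraph D) k = \<gamma> v"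
    then have "card (star_part G \<kappa> v k) = d k"
      using assms(2) by (auto simp: equitable_hom_def)
    then have "bij_betw (F v k) (star_part G \<kappa> v k) {..<d k}"
      using F[of v k] by simp
    then show "bij_betw (\<lambda>e. F (tail (dgraph G) e) (\<kappa> e) e) (star_part G \<kappa> v k) {..<d k}"
      by (rule bij_betw_cong[THEN iffD1, rotated]) auto
  qed
qed

text \<open>The fibre over \<open>k\<close> is the disjoint union of the star parts at the vertices
  over the tail of \<open>k\<close>, each of size \<open>d k\<close>.\<close>

lemma equitable_hom_card_arcs:
  assumes "finite_graph G" "equitable_hom G D \<gamma> \<kappa> d" "k \<in> arcs (dgraph D)"
  shows "card {e \<in> arcs (dgraph G). \<kappa> e = k} =
    card {v \<in> verts (dgraph G). \<gamma> v = tail (dgraph D) k} * d k"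
proof -
  interpret fin_digraph "dgraph G" using assms(1) by (simp add: finite_graph_def)
  let ?V = "{v \<in> verts (dgraph G). \<gamma> v = tail (dgraph D) k}"
  have "{e \<in> arcs (dgraph G). \<kappa> e = k} = (\<Union>v\<in>?V. star_part G \<kappa> v k)"
    using assms(2) by (auto simp: equitable_hom_def graph_hom_def)
  also have "card \<dots> = (\<Sum>v\<in>?V. card (star_part G \<kappa> v k))"
    by (rule card_UN_disjoint) (auto simp: star_part_def)
  also have "\<dots> = (\<Sum>v\<in>?V. d k)"
    using assms(2,3) by (intro sum.cong) (auto simp: equitable_hom_def)
  finally show ?thesis by simp
qed

section \<open>The slot product and its two projections\<close>

text \<open>\<open>a\<close> and \<open>b\<close> are the numbers of copies over vertices and arcs
  of \<open>D\<close>. By \<open>slots\<close> the copies of a vertex pair split into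
  \<open>b\<close> blocks of length \<open>d\<close>; by \<open>slots_rev\<close> an arc and its
  reverse have equally many copies. Both are asked where \<open>G\<close> has a lift, since there
  the fibres are nonempty and the sizes can be balanced.\<close>

locale slot_product =
  fixes G :: "('v, 'e, 'a, 'b) colored_graph"
    and G' :: "('w, 'f, 'a, 'b) colored_graph"
    and D :: "('i, 'k, 'a, 'b) colored_graph"
    and \<gamma> \<kappa> \<gamma>' \<kappa>' and d b :: "'k \<Rightarrow> nat" and a :: "'i \<Rightarrow> nat"
    and \<rho> :: "'e \<Rightarrow> nat" and \<rho>' :: "'f \<Rightarrow> nat"
  assumes bi: "bidirected_digraph (dgraph G) (erev G)"
    and bi': "bidirected_digraph (dgraph G') (erev G')"
    and hom: "graph_hom G D \<gamma> \<kappa>" "color_preserving G D \<gamma> \<kappa>"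
    and hom': "graph_hom G' D \<gamma>' \<kappa>'" "color_preserving G' D \<gamma>' \<kappa>'"
    and rank: "\<And>v k. \<lbrakk>v \<in> verts (dgraph G); k \<in> arcs (dgraph D); tail (dgraph D) k = \<gamma> v\<rbrakk> \<Longrightarrow>
      bij_betw \<rho> (star_part G \<kappa> v k) {..<d k}"
    and rank': "\<And>v k. \<lbrakk>v \<in> verts (dgraph G'); k \<in> arcs (dgraph D); tail (dgraph D) k = \<gamma>' v\<rbrakk> \<Longrightarrow>
      bij_betw \<rho>' (star_part G' \<kappa>' v k) {..<d k}"
    and slots: "\<And>e. e \<in> arcs (dgraph G) \<Longrightarrow> a (tail (dgraph D) (\<kappa> e)) = d (\<kappa> e) * b (\<kappa> e)"
    and slots_rev: "\<And>e. e \<in> arcs (dgraph G) \<Longrightarrow> b (erev D (\<kappa> e)) = b (\<kappa> e)"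
begin

sublocale G: bidirected_digraph "dgraph G" "erev G" by (rule bi)
sublocale G': bidirected_digraph "dgraph G'" "erev G'" by (rule bi')

definition prod_verts :: "('v \<times> 'w \<times> nat) set" where
  "prod_verts = {(v, v', x). v \<in> verts (dgraph G) \<and> v' \<in> verts (dgraph G') \<and> \<gamma> v = \<gamma>' v' \<and> x < a (\<gamma> v)}"

definition prod_arcs :: "('e \<times> 'f \<times> nat) set" where
  "prod_arcs = {(e, e', y). e \<in> arcs (dgraph G) \<and> e' \<in> arcs (dgraph G') \<and> \<kappa> e = \<kappa>' e' \<and> y < b (\<kappa> e)}"

text \<open>Copy \<open>y\<close> of a pair of arcs starts in block \<open>y\<close> of
  \<open>d (\<kappa> e)\<close> consecutive vertex copies, at the position given by a cyclic Latin
  square: with either arc fixed, the other runs through every position of the block once.\<close>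

definition prod_tail :: "'e \<times> 'f \<times> nat \<Rightarrow> 'v \<times> 'w \<times> nat" where
  "prod_tail = (\<lambda>(e, e', y). (tail (dgraph G) e, tail (dgraph G') e',
     y * d (\<kappa> e) + (\<rho> e + \<rho>' e') mod d (\<kappa> e)))"

definition prod_rev :: "'e \<times> 'f \<times> nat \<Rightarrow> 'e \<times> 'f \<times> nat" where
  "prod_rev p = (if p \<in> prod_arcs then (erev G (fst p), erev G' (fst (snd p)), snd (snd p)) else p)"

text \<open>Taking the head to be the tail of the reversed arc makes the reversal law immediate and
  avoids a second dealing for incoming arcs.\<close>

definition slot_prod :: "('v \<times> 'w \<times> nat, 'e \<times> 'f \<times> nat, 'a, 'b) colored_graph" where
  "slot_prod = \<lparr>dgraph = \<lparr>verts = prod_verts, arcs = prod_arcs, tail = prod_tail,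
      head = prod_tail \<circ> prod_rev\<rparr>,
    erev = prod_rev, vcolor = vcolor G \<circ> fst, ecolor = ecolor G \<circ> fst\<rparr>"

lemma hom_simps:
  "v \<in> verts (dgraph G) \<Longrightarrow> vcolor D (\<gamma> v) = vcolor G v"
  "e \<in> arcs (dgraph G) \<Longrightarrow> ecolor D (\<kappa> e) = ecolor G e"
  "e \<in> arcs (dgraph G) \<Longrightarrow> \<kappa> e \<in> arcs (dgraph D)"
  "e \<in> arcs (dgraph G) \<Longrightarrow> \<gamma> (tail (dgraph G) e) = tail (dgraph D) (\<kappa> e)"
  "e \<in> arcs (dgraph G) \<Longrightarrow> \<kappa> (erev G e) = erev D (\<kappa> e)"
  "v' \<in> verts (dgraph G') \<Longrightarrow> vcolor D (\<gamma>' v') = vcolor G' v'"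
  "e' \<in> arcs (dgraph G') \<Longrightarrow> ecolor D (\<kappa>' e') = ecolor G' e'"
  "e' \<in> arcs (dgraph G') \<Longrightarrow> \<kappa>' e' \<in> arcs (dgraph D)"
  "e' \<in> arcs (dgraph G') \<Longrightarrow> \<gamma>' (tail (dgraph G') e') = tail (dgraph D) (\<kappa>' e')"
  "e' \<in> arcs (dgraph G') \<Longrightarrow> \<kappa>' (erev G' e') = erev D (\<kappa>' e')"
  using hom hom' by (auto simp: graph_hom_def color_preserving_def)

lemma prod_rev_in_arcs: "p \<in> prod_arcs \<Longrightarrow> prod_rev p \<in> prod_arcs"
  using slots_rev[of "fst p"] by (auto simp: prod_rev_def prod_arcs_def hom_simps)

lemma prod_tail_in_verts:
  assumes "p \<in> prod_arcs" shows "prod_tail p \<in> prod_verts"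
proof -
  obtain e e' y where p: "p = (e, e', y)" by (cases p) auto
  have e: "e \<in> arcs (dgraph G)" "e' \<in> arcs (dgraph G')" "\<kappa> e = \<kappa>' e'" "y < b (\<kappa> e)"
    using assms by (auto simp: p prod_arcs_def)
  \<comment> \<open>The number of \<open>e\<close> lies below \<open>d (\<kappa> e)\<close>, so this
    multiplicity is positive and the remainder in \<open>prod_tail\<close> stays within its
    block.\<close>
  have "e \<in> star_part G \<kappa> (tail (dgraph G) e) (\<kappa> e)" using e by simp
  then have "\<rho> e \<in> {..<d (\<kappa> e)}"
    using e by (intro bij_betw_apply[OF rank]) (auto simp: hom_simps)
  then have "0 < d (\<kappa> e)" by auto
  then have "y * d (\<kappa> e) + (\<rho> e + \<rho>' e') mod d (\<kappa> e) < Suc y * d (\<kappa> e)" by simp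
  also have "\<dots> \<le> b (\<kappa> e) * d (\<kappa> e)" using e by (intro mult_le_mono) auto
  finally show ?thesis
    using e slots[of e] by (auto simp: p prod_tail_def prod_verts_def hom_simps mult.commute)
qed

text \<open>Reversal changes the first component because \<open>G\<close> has no half-edges, so a
  half-edge of \<open>D\<close> produces none here.\<close>

lemma bidirected_slot_prod: "bidirected_digraph (dgraph slot_prod) (erev slot_prod)"
proof
  fix p
  show "p \<in> arcs (dgraph slot_prod) \<longleftrightarrow> erev slot_prod p \<noteq> p"
    by (auto simp: slot_prod_def prod_rev_def) (auto simp: prod_arcs_def dest: G.arev_neq)
next
  fix p assume "p \<in> arcs (dgraph slot_prod)"
  then show "erev slot_prod (erev slot_prod p) = p"
    using prod_rev_in_arcs[of p] by (auto simp: slot_prod_def prod_rev_def)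
qed (auto simp: slot_prod_def prod_tail_in_verts prod_rev_in_arcs)

lemma finite_slot_prod:
  assumes "finite_graph G" "finite_graph G'"
  shows "finite_graph slot_prod"
proof -
  interpret bidirected_digraph "dgraph slot_prod" "erev slot_prod" by (rule bidirected_slot_prod)
  interpret F: fin_digraph "dgraph G" using assms by (simp add: finite_graph_def)
  interpret F': fin_digraph "dgraph G'" using assms by (simp add: finite_graph_def)
  have "prod_verts \<subseteq> verts (dgraph G) \<times> verts (dgraph G') \<times> (\<Union>v\<in>verts (dgraph G). {..<a (\<gamma> v)})"
    by (auto simp: prod_verts_def)
  then have "finite prod_verts" by (rule finite_subset) auto
  have "prod_arcs \<subseteq> arcs (dgraph G) \<times> arcs (dgraph G') \<times> (\<Union>e\<in>arcs (dgraph G). {..<b (\<kappa> e)})"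
    by (auto simp: prod_arcs_def)
  then have "finite prod_arcs" by (rule finite_subset) auto
  with \<open>finite prod_verts\<close> show ?thesis
    unfolding finite_graph_def by (intro fin_digraphI) (simp_all add: slot_prod_def)
qed

lemma out_arcs_slot_prod:
  assumes "(v, v', x) \<in> prod_verts"
  shows "out_arcs (dgraph slot_prod) (v, v', x) =
    {(e, e', y). e \<in> out_arcs (dgraph G) v \<and> e' \<in> star_part G' \<kappa>' v' (\<kappa> e) \<and> y < b (\<kappa> e) \<and>
      y * d (\<kappa> e) + (\<rho> e + \<rho>' e') mod d (\<kappa> e) = x}"
  by (auto simp: slot_prod_def prod_arcs_def prod_tail_def)

text \<open>For a fixed arc \<open>e\<close> at \<open>v\<close>, \<open>ex1_slot\<close> with
  \<open>r = \<rho> e\<close> and \<open>\<sigma> = \<rho>'\<close> gives exactly one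
  \<open>(e', y)\<close> that completes it to an arc out of copy \<open>x\<close>.\<close>

lemma bij_betw_fst_star:
  assumes p: "(v, v', x) \<in> prod_verts"
  shows "bij_betw fst (out_arcs (dgraph slot_prod) (v, v', x)) (out_arcs (dgraph G) v)"
proof -
  have *: "\<exists>!q. q \<in> star_part G' \<kappa>' v' (\<kappa> e) \<times> {..<b (\<kappa> e)} \<and>
      snd q * d (\<kappa> e) + (\<rho> e + \<rho>' (fst q)) mod d (\<kappa> e) = x"
    if "e \<in> out_arcs (dgraph G) v" for e
  proof (rule ex1_slot)
    have "\<kappa> e \<in> arcs (dgraph D)" "tail (dgraph D) (\<kappa> e) = \<gamma> v"
      using that by (auto simp: hom_simps)
    then show "bij_betw \<rho>' (star_part G' \<kappa>' v' (\<kappa> e)) {..<d (\<kappa> e)}" "x < d (\<kappa> e) * b (\<kappa> e)"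
      using p that rank' slots[of e] by (auto simp: prod_verts_def)
  qed
  show ?thesis
    unfolding out_arcs_slot_prod[OF p]
  proof (rule bij_betwI', goal_cases)
    case (1 q r)
    obtain e e' y f f' z where qr: "q = (e, e', y)" "r = (f, f', z)" by (cases q, cases r)
    show ?case
    proof
      assume "fst q = fst r"
      then have f: "f = e" by (simp add: qr)
      have "e \<in> out_arcs (dgraph G) v" using 1(1) by (simp add: qr)
      moreover have "e' \<in> star_part G' \<kappa>' v' (\<kappa> e) \<and> y < b (\<kappa> e) \<and>
          y * d (\<kappa> e) + (\<rho> e + \<rho>' e') mod d (\<kappa> e) = x"
        using 1(1) unfolding qr by blast
      moreover have "f' \<in> star_part G' \<kappa>' v' (\<kappa> e) \<and> z < b (\<kappa> e) \<and>
          z * d (\<kappa> e) + (\<rho> e + \<rho>' f') mod d (\<kappa> e) = x"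
        using 1(2) unfolding qr f by blast
      ultimately have "(e', y) = (f', z)"
        by (intro ex1D[OF *[of e]]) simp_all
      then show "q = r" by (simp add: qr f)
    qed simp
  next
    case (3 e)
    obtain e' y where "e' \<in> star_part G' \<kappa>' v' (\<kappa> e)" "y < b (\<kappa> e)"
        "y * d (\<kappa> e) + (\<rho> e + \<rho>' e') mod d (\<kappa> e) = x"
      using ex1_implies_ex[OF *[OF 3]] by (metis mem_Times_iff lessThan_iff)
    then show ?case using 3 by (intro bexI[of _ "(e, e', y)"]) (simp, blast)
  qed auto
qed

text \<open>The two numberings exchange roles, which the commutative sum in \<open>prod_tail\<close>
  permits.\<close>

lemma bij_betw_snd_star:
  assumes p: "(v, v', x) \<in> prod_verts"
  shows "bij_betw (fst \<circ> snd) (out_arcs (dgraph slot_prod) (v, v', x)) (out_arcs (dgraph G') v')"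
proof -
  have *: "\<exists>!q. q \<in> star_part G \<kappa> v (\<kappa>' e') \<times> {..<b (\<kappa>' e')} \<and>
      snd q * d (\<kappa>' e') + (\<rho>' e' + \<rho> (fst q)) mod d (\<kappa>' e') = x"
    if "e' \<in> out_arcs (dgraph G') v'" for e'
  proof (rule ex1_slot)
    have k: "\<kappa>' e' \<in> arcs (dgraph D)" "tail (dgraph D) (\<kappa>' e') = \<gamma> v"
      using that p by (auto simp: hom_simps prod_verts_def)
    then show r: "bij_betw \<rho> (star_part G \<kappa> v (\<kappa>' e')) {..<d (\<kappa>' e')}"
      using p rank by (auto simp: prod_verts_def)
    \<comment> \<open>\<open>slots\<close> speaks of arcs of \<open>G\<close>, so an arc of
      \<open>G\<close> at \<open>v\<close> in the class of \<open>e'\<close> is needed. It exists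
      because the number of \<open>e'\<close> forces \<open>d (\<kappa>' e')\<close> to be
      positive.\<close>
    have "\<rho>' e' \<in> {..<d (\<kappa>' e')}"
      using k p that by (intro bij_betw_apply[OF rank'[of v' "\<kappa>' e'"]]) (auto simp: prod_verts_def)
    then have "0 < d (\<kappa>' e')" by auto
    then obtain e where "e \<in> star_part G \<kappa> v (\<kappa>' e')"
      using r by (metis bij_betw_def imageE lessThan_iff)
    then have "a (\<gamma> v) = d (\<kappa>' e') * b (\<kappa>' e')"
      using slots[of e] k by auto
    then show "x < d (\<kappa>' e') * b (\<kappa>' e')" using p by (auto simp: prod_verts_def)
  qed
  have star: "out_arcs (dgraph slot_prod) (v, v', x) =
    {(e, e', y). e' \<in> out_arcs (dgraph G') v' \<and> e \<in> star_part G \<kappa> v (\<kappa>' e') \<and> y < b (\<kappa>' e') \<and>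
      y * d (\<kappa>' e') + (\<rho>' e' + \<rho> e) mod d (\<kappa>' e') = x}"
    unfolding out_arcs_slot_prod[OF p] by (auto simp: add.commute)
  show ?thesis
    unfolding star
  proof (rule bij_betwI', goal_cases)
    case (1 q r)
    obtain e e' y f f' z where qr: "q = (e, e', y)" "r = (f, f', z)" by (cases q, cases r)
    show ?case
    proof
      assume "(fst \<circ> snd) q = (fst \<circ> snd) r"
      then have f: "f' = e'" by (simp add: qr)
      have "e' \<in> out_arcs (dgraph G') v'" using 1(1) by (simp add: qr)
      moreover have "e \<in> star_part G \<kappa> v (\<kappa>' e') \<and> y < b (\<kappa>' e') \<and>
          y * d (\<kappa>' e') + (\<rho>' e' + \<rho> e) mod d (\<kappa>' e') = x"
        using 1(1) unfolding qr by blast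
      moreover have "f \<in> star_part G \<kappa> v (\<kappa>' e') \<and> z < b (\<kappa>' e') \<and>
          z * d (\<kappa>' e') + (\<rho>' e' + \<rho> f) mod d (\<kappa>' e') = x"
        using 1(2) unfolding qr f by blast
      ultimately have "(e, y) = (f, z)"
        by (intro ex1D[OF *[of e']]) simp_all
      then show "q = r" by (simp add: qr f)
    qed simp
  next
    case (3 e')
    obtain e y where "e \<in> star_part G \<kappa> v (\<kappa>' e')" "y < b (\<kappa>' e')"
        "y * d (\<kappa>' e') + (\<rho>' e' + \<rho> e) mod d (\<kappa>' e') = x"
      using ex1_implies_ex[OF *[OF 3]] by (metis mem_Times_iff lessThan_iff)
    then show ?case using 3 by (intro bexI[of _ "(e, e', y)"]) auto
  qed auto
qed

lemma covering_fst: "colored_covering slot_prod G fst fst"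
  unfolding colored_covering_def
proof (intro conjI ballI)
  show "graph_hom slot_prod G fst fst"
    by (auto simp: graph_hom_def slot_prod_def prod_verts_def prod_tail_def prod_rev_def)
      (auto simp: prod_arcs_def)
  show "bij_betw fst (out_arcs (dgraph slot_prod) p) (out_arcs (dgraph G) (fst p))"
    if "p \<in> verts (dgraph slot_prod)" for p
    using that bij_betw_fst_star by (cases p) (auto simp: slot_prod_def)
qed (auto simp: color_preserving_def slot_prod_def)

lemma covering_snd: "colored_covering slot_prod G' (fst \<circ> snd) (fst \<circ> snd)"
  unfolding colored_covering_def
proof (intro conjI ballI)
  show "graph_hom slot_prod G' (fst \<circ> snd) (fst \<circ> snd)"
    by (auto simp: graph_hom_def slot_prod_def prod_verts_def prod_tail_def prod_rev_def)
      (auto simp: prod_arcs_def)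
  show "bij_betw (fst \<circ> snd) (out_arcs (dgraph slot_prod) p) (out_arcs (dgraph G') ((fst \<circ> snd) p))"
    if "p \<in> verts (dgraph slot_prod)" for p
    using that bij_betw_snd_star by (cases p) (auto simp: slot_prod_def)
  \<comment> \<open>The product takes its colors from \<open>G\<close>; they agree with those of
    \<open>G'\<close> since both colorings factor through \<open>D\<close>.\<close>
  show "color_preserving slot_prod G' (fst \<circ> snd) (fst \<circ> snd)"
    by (auto simp: color_preserving_def slot_prod_def prod_verts_def prod_arcs_def)
      (metis hom_simps(1,6), metis hom_simps(2,7))
qed

end

section \<open>Choice of the numbers of copies\<close>

text \<open>The numbers of copies are computed from \<open>G\<close> alone; \<open>G'\<close> fits
  them because it has the same multiplicities \<open>d\<close>.\<close>

lemma finite_common_cover_if_equitable: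
  fixes G :: "('v, 'e, 'a, 'b) colored_graph" and G' :: "('w, 'f, 'a, 'b) colored_graph"
    and D :: "('i, 'k, 'a, 'b) colored_graph"
  assumes G: "bidirected_digraph (dgraph G) (erev G)" "finite_graph G" "equitable_hom G D \<gamma> \<kappa> d"
    and G': "bidirected_digraph (dgraph G') (erev G')" "finite_graph G'" "equitable_hom G' D \<gamma>' \<kappa>' d"
    and v: "v \<in> verts (dgraph G)" "v' \<in> verts (dgraph G')" "\<gamma> v = \<gamma>' v'"
  obtains K :: "('v \<times> 'w \<times> nat, 'e \<times> 'f \<times> nat, 'a, 'b) colored_graph" and \<phi> \<psi> \<phi>' \<psi>'
  where "bidirected_digraph (dgraph K) (erev K)" "finite_graph K" "verts (dgraph K) \<noteq> {}"
    "colored_covering K G \<phi> \<psi>" "colored_covering K G' \<phi>' \<psi>'"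
proof -
  interpret G: bidirected_digraph "dgraph G" "erev G" by (rule G)
  interpret G': bidirected_digraph "dgraph G'" "erev G'" by (rule G')
  interpret F: fin_digraph "dgraph G" using G by (simp add: finite_graph_def)
  obtain \<rho> where \<rho>: "\<And>v k. v \<in> verts (dgraph G) \<Longrightarrow> k \<in> arcs (dgraph D) \<Longrightarrow>
      tail (dgraph D) k = \<gamma> v \<Longrightarrow> bij_betw \<rho> (star_part G \<kappa> v k) {..<d k}"
    using equitable_hom_ranking[OF G(2,3)] by blast
  obtain \<rho>' where \<rho>': "\<And>v k. v \<in> verts (dgraph G') \<Longrightarrow> k \<in> arcs (dgraph D) \<Longrightarrow>
      tail (dgraph D) k = \<gamma>' v \<Longrightarrow> bij_betw \<rho>' (star_part G' \<kappa>' v k) {..<d k}"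
    using equitable_hom_ranking[OF G'(2,3)] by blast
  have hom: "graph_hom G D \<gamma> \<kappa>" "color_preserving G D \<gamma> \<kappa>"
    and hom': "graph_hom G' D \<gamma>' \<kappa>'" "color_preserving G' D \<gamma>' \<kappa>'"
    using G(3) G'(3) by (auto simp: equitable_hom_def)
  have \<kappa>: "\<kappa> e \<in> arcs (dgraph D)" "\<kappa> (erev G e) = erev D (\<kappa> e)" if "e \<in> arcs (dgraph G)" for e
    using hom(1) that by (auto simp: graph_hom_def)
  \<comment> \<open>Every positive number up to \<open>N\<close> divides \<open>fact N\<close>, so
    \<open>s\<close> is a common multiple of the sizes of all nonempty fibres over vertices and
    arcs.\<close>
  define s :: nat where "s = fact (card (verts (dgraph G))) * fact (card (arcs (dgraph G)))"
  define n where "n i = card {v \<in> verts (dgraph G). \<gamma> v = i}" for i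
  define m where "m k = card {e \<in> arcs (dgraph G). \<kappa> e = k}" for k
  have "0 < s" by (simp add: s_def)
  have n: "0 < n (\<gamma> v)" "n (\<gamma> v) dvd s" if "v \<in> verts (dgraph G)" for v
  proof -
    have "{w \<in> verts (dgraph G). \<gamma> w = \<gamma> v} \<noteq> {}" using that by auto
    then show "0 < n (\<gamma> v)" by (simp add: n_def card_gt_0_iff)
    moreover have "n (\<gamma> v) \<le> card (verts (dgraph G))"
      unfolding n_def by (rule card_mono) auto
    ultimately show "n (\<gamma> v) dvd s"
      unfolding s_def by (intro dvd_mult2 dvd_fact) auto
  qed
  have m: "0 < m (\<kappa> e)" "m (\<kappa> e) dvd s" if "e \<in> arcs (dgraph G)" for e
  proof -
    have "{f \<in> arcs (dgraph G). \<kappa> f = \<kappa> e} \<noteq> {}" using that by auto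
    then show "0 < m (\<kappa> e)" by (simp add: m_def card_gt_0_iff)
    moreover have "m (\<kappa> e) \<le> card (arcs (dgraph G))"
      unfolding m_def by (rule card_mono) auto
    ultimately show "m (\<kappa> e) dvd s"
      unfolding s_def by (intro dvd_mult dvd_fact) auto
  qed
  interpret slot_product G G' D \<gamma> \<kappa> \<gamma>' \<kappa>' d "\<lambda>k. s div m k" "\<lambda>i. s div n i" \<rho> \<rho>'
  proof (unfold_locales; (rule G G' hom hom' \<rho> \<rho>'; assumption?)?)
    fix e assume e: "e \<in> arcs (dgraph G)"
    have mk: "m (\<kappa> e) = n (tail (dgraph D) (\<kappa> e)) * d (\<kappa> e)"
      unfolding m_def n_def using equitable_hom_card_arcs[OF G(2,3) \<kappa>(1)[OF e]] .
    \<comment> \<open>As \<open>m = n * d\<close>, this gives \<open>s = n * d * t\<close>, hence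
      \<open>s div n = d * t\<close> and \<open>s div m = t\<close>.\<close>
    obtain t where t: "s = m (\<kappa> e) * t" using m(2)[OF e] by auto
    show "s div n (tail (dgraph D) (\<kappa> e)) = d (\<kappa> e) * (s div m (\<kappa> e))"
      using m(1)[OF e] unfolding t mk by (simp add: mult.assoc)
    have rev: "erev D (erev D (\<kappa> e)) = \<kappa> e"
      using \<kappa>(2)[OF e] \<kappa>(2)[of "erev G e"] e by simp
    \<comment> \<open>Reversal in \<open>G\<close> exchanges the fibres over
      \<open>\<kappa> e\<close> and over its reverse, also when the two coincide.\<close>
    have "bij_betw (erev G) {f \<in> arcs (dgraph G). \<kappa> f = \<kappa> e} {f \<in> arcs (dgraph G). \<kappa> f = erev D (\<kappa> e)}"
      by (rule bij_betw_byWitness[of _ "erev G"]) (auto simp: \<kappa> rev)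
    then have "m (erev D (\<kappa> e)) = m (\<kappa> e)"
      unfolding m_def by (rule bij_betw_same_card[symmetric])
    then show "s div m (erev D (\<kappa> e)) = s div m (\<kappa> e)" by simp
  qed
  \<comment> \<open>Copy \<open>0\<close> exists because the positive number
    \<open>n (\<gamma> v)\<close> divides \<open>s > 0\<close>, so the quotient is positive.\<close>
  have "(v, v', 0) \<in> verts (dgraph slot_prod)"
    using v n[OF v(1)] \<open>0 < s\<close> by (auto simp: slot_prod_def prod_verts_def dvd_imp_le div_greater_zero_iff)
  then have "verts (dgraph slot_prod) \<noteq> {}" by blast
  with bidirected_slot_prod finite_slot_prod[OF G(2) G'(2)] show thesis
    using covering_fst covering_snd by (rule that)
qed

section \<open>Assembly of the finite common covering\<close>

theorem theorem1p1:
  fixes C :: "('a, 'b) rev_graph"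
    and G :: "('v, 'e, 'a, 'b) colored_graph"
    and G' :: "('w, 'f, 'a, 'b) colored_graph"
  assumes "graph_of_colors C"
    and "connected_graph G" and "finite_graph G" and "colored_by G C"
    and "connected_graph G'" and "finite_graph G'" and "colored_by G' C"
    and "\<exists>H :: ('x, 'g, 'a, 'b) colored_graph. common_covering C G G' H"
  shows "\<exists>K :: (nat, nat, 'a, 'b) colored_graph. common_covering C G G' K \<and> finite_graph K"
proof -
  have biG: "bidirected_digraph (dgraph G) (erev G)" and biG': "bidirected_digraph (dgraph G') (erev G')"
    using assms by (auto simp: connected_graph_def)
  from assms(8) obtain H :: "('x, 'g, 'a, 'b) colored_graph" and \<phi> \<psi> \<phi>' \<psi>'
    where H: "connected_graph H"
      and cov: "colored_covering H G \<phi> \<psi>" and cov': "colored_covering H G' \<phi>' \<psi>'"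
    unfolding common_covering_def by blast
  from H have biH: "bidirected_digraph (dgraph H) (erev H)" and neH: "verts (dgraph H) \<noteq> {}"
    by (auto simp: connected_graph_def connected_conv)
  obtain D :: "('x set, 'g set, 'a, 'b) colored_graph" and p q d where
    D: "equitable_hom H D p q d" and
    p: "\<forall>h \<in> verts (dgraph H). \<forall>h' \<in> verts (dgraph H). \<phi> h = \<phi> h' \<or> \<phi>' h = \<phi>' h' \<longrightarrow> p h = p h'" and
    q: "\<forall>g \<in> arcs (dgraph H). \<forall>g' \<in> arcs (dgraph H). \<psi> g = \<psi> g' \<or> \<psi>' g = \<psi>' g' \<longrightarrow> q g = q g'"
    using common_equitable_quotient[OF cov cov' biH] by blast
  have "\<exists>\<gamma> \<kappa>. equitable_hom G D \<gamma> \<kappa> d \<and> (\<forall>h \<in> verts (dgraph H). \<gamma> (\<phi> h) = p h)"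
    using p q by (intro equitable_hom_descend[OF cov H assms(2) D]) blast+
  then obtain \<gamma> \<kappa> where \<gamma>: "equitable_hom G D \<gamma> \<kappa> d" "\<forall>h \<in> verts (dgraph H). \<gamma> (\<phi> h) = p h"
    by blast
  have "\<exists>\<gamma> \<kappa>. equitable_hom G' D \<gamma> \<kappa> d \<and> (\<forall>h \<in> verts (dgraph H). \<gamma> (\<phi>' h) = p h)"
    using p q by (intro equitable_hom_descend[OF cov' H assms(5) D]) blast+
  then obtain \<gamma>' \<kappa>' where \<gamma>': "equitable_hom G' D \<gamma>' \<kappa>' d" "\<forall>h \<in> verts (dgraph H). \<gamma>' (\<phi>' h) = p h"
    by blast
  \<comment> \<open>One vertex of \<open>H\<close> yields a vertex of \<open>G\<close> and one of
    \<open>G'\<close> over the same vertex of \<open>D\<close>, which makes the product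
    nonempty.\<close>
  obtain h where h: "h \<in> verts (dgraph H)" using neH by blast
  have "\<phi> h \<in> verts (dgraph G)" "\<phi>' h \<in> verts (dgraph G')" "\<gamma> (\<phi> h) = \<gamma>' (\<phi>' h)"
    using h \<gamma>(2) \<gamma>'(2) colored_coveringD(1)[OF cov] colored_coveringD(1)[OF cov'] by auto
  then obtain K :: "('v \<times> 'w \<times> nat, 'e \<times> 'f \<times> nat, 'a, 'b) colored_graph" and \<alpha> \<beta> \<alpha>' \<beta>'
    where K: "bidirected_digraph (dgraph K) (erev K)" "finite_graph K" "verts (dgraph K) \<noteq> {}"
      and KG: "colored_covering K G \<alpha> \<beta>" and KG': "colored_covering K G' \<alpha>' \<beta>'"
    using finite_common_cover_if_equitable[OF biG assms(3) \<gamma>(1) biG' assms(6) \<gamma>'(1)] by blast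
  interpret K: fin_digraph "dgraph K" using K by (simp add: finite_graph_def)
  obtain f :: "_ \<Rightarrow> nat" and g :: "_ \<Rightarrow> nat" where "inj_on f (verts (dgraph K))" "inj_on g (arcs (dgraph K))"
    using finite_imp_inj_to_nat_seg K.finite_verts K.finite_arcs by metis
  note L = relabel_covering[OF K(1,2) this]
  define L where "L = relabel f g K"
  obtain u where "u \<in> verts (dgraph L)"
    using K(3) by (auto simp: L_def relabel_def Let_def)
  note M = component_covering[OF L(1,2)[folded L_def] this]
  define M where "M = induced_colored L {v. u \<rightarrow>\<^sup>*\<^bsub>dgraph L\<^esub> v}"
  \<comment> \<open>The component \<open>M\<close> covers the relabelled graph \<open>L\<close>,
    which covers \<open>K\<close>; composing with the two coverings of \<open>K\<close> reaches
    \<open>G\<close> and \<open>G'\<close>.\<close>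
  note MK = colored_covering_comp[OF M(3) L(3)[folded L_def], folded M_def]
  note MG = colored_covering_comp[OF MK KG] and MG' = colored_covering_comp[OF MK KG']
  have "colored_by M C"
    using M(1)[folded M_def] by (intro colored_covering_colored_by[OF MG assms(4)]) (simp add: connected_graph_def)
  then have "common_covering C G G' M"
    unfolding common_covering_def using M(1)[folded M_def] MG MG' by blast
  then show ?thesis using M(2)[folded M_def] by blast
qed

end
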